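(* There are no vertex-critical graphs in $\mathcal{H}$; that is, for every positive integer $k$, no graph in the class $\mathcal{H}$ is $k$-vertex-critical.
   Context: All graphs are finite and simple. $\chi(G)$ denotes the chromatic number. A graph $G$ is $k$-vertex-critical if $\chi(G)=k$ and $\chi(G-v)<k$ for all $v\in V(G)$. $P_n$ is the path on $n$ vertices; the gem is $P_4$ plus a vertex adjacent to all four of its vertices. A graph is $(P_5,\text{gem})$-free if it contains neither $P_5$ nor the gem as an induced subgraph. For $S,T\subseteq V(G)$, $S$ is complete (anti-complete) to $T$ if every $s\in S$ is adjacent (non-adjacent) to every $t\in T$. A module of $G$ is a set $S\subseteq V(G)$ such that every vertex of $V(G)\setminus S$ is either complete or anti-complete to $S$. $\mathcal{H}$ is the class of $(P_5,\text{gem})$-free graphs $G$ such that $V(G)$ can be partitioned into seven non-empty sets $A_1,\ldots,A_7$ such that: (1) $A_1$ is complete to $A_2\cup A_5\cup A_6$ and anti-complete to $A_3\cup A_4\cup A_7$; (2) $A_2$ is complete to $A_1\cup A_3$ and anti-complete to $A_4\cup A_5\cup A_6\cup A_7$; (3) $A_3$ is complete to $A_2\cup A_4\cup A_6$ and anti-complete to $A_1\cup A_5\cup A_7$; (4) $A_4$ is complete to $A_3\cup A_5\cup A_6$ and anti-complete to $A_1\cup A_2\cup A_7$; (5) $A_5$ is complete to $A_1\cup A_4$ and anti-complete to $A_2\cup A_3\cup A_6\cup A_7$; (6) the vertex set of every component of $G[A_7]$ is a module of $G$; (7) every vertex in $A_7$ has a neighbour in $A_6$. *)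

theory Defs
  imports "Graph_Theory.Graph_Theory"
begin

text \<open>
  Finite simple graphs are the digraphs satisfying the locale predicate \<^const>\<open>graph\<close>: finite,
  loop-free, without parallel arcs, and symmetric. Two vertices are adjacent iff there is an arc
  from one to the other (equivalently, in both directions). The graph without vertices is allowed.
\<close>

definition proper_colouring :: "('a,'b) pre_digraph \<Rightarrow> nat \<Rightarrow> ('a \<Rightarrow> nat) \<Rightarrow> bool" where
  "proper_colouring G k c \<longleftrightarrow>
     (\<forall>v \<in> verts G. c v < k) \<and> (\<forall>u \<in> verts G. \<forall>v \<in> verts G. u \<rightarrow>\<^bsub>G\<^esub> v \<longrightarrow> c u \<noteq> c v)"

definition colourable :: "('a,'b) pre_digraph \<Rightarrow> nat \<Rightarrow> bool" where
  "colourable G k \<longleftrightarrow> (\<exists>c. proper_colouring G k c)"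

definition chromatic_number :: "('a,'b) pre_digraph \<Rightarrow> nat" where
  "chromatic_number G = (LEAST k. colourable G k)"

definition vertex_critical :: "nat \<Rightarrow> ('a,'b) pre_digraph \<Rightarrow> bool" where
  "vertex_critical k G \<longleftrightarrow>
     chromatic_number G = k \<and>
     (\<forall>v \<in> verts G. chromatic_number (pre_digraph.del_vert G v) < k)"

definition contains_induced :: "('a,'b) pre_digraph \<Rightarrow> ('c,'d) pre_digraph \<Rightarrow> bool" where
  "contains_induced G F \<longleftrightarrow> (\<exists>H. induced_subgraph H G \<and> digraph_iso H F)"

definition path_graph :: "nat \<Rightarrow> nat pair_pre_digraph" where
  "path_graph n =
     \<lparr> pverts = {..<n}, parcs = {(i, j). i < n \<and> j < n \<and> (j = Suc i \<or> i = Suc j)} \<rparr>"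

definition gem :: "nat pair_pre_digraph" where
  "gem = \<lparr> pverts = insert 4 (pverts (path_graph 4)),
           parcs = parcs (path_graph 4) \<union> pverts (path_graph 4) \<times> {4} \<union> {4} \<times> pverts (path_graph 4) \<rparr>"

definition P5_gem_free :: "('a,'b) pre_digraph \<Rightarrow> bool" where
  "P5_gem_free G \<longleftrightarrow>
     \<not> contains_induced G (with_proj (path_graph 5)) \<and> \<not> contains_induced G (with_proj gem)"

definition complete_to :: "('a,'b) pre_digraph \<Rightarrow> 'a set \<Rightarrow> 'a set \<Rightarrow> bool" where
  "complete_to G S T \<longleftrightarrow> (\<forall>s \<in> S. \<forall>t \<in> T. s \<rightarrow>\<^bsub>G\<^esub> t)"

definition anticomplete_to :: "('a,'b) pre_digraph \<Rightarrow> 'a set \<Rightarrow> 'a set \<Rightarrow> bool" where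
  "anticomplete_to G S T \<longleftrightarrow> (\<forall>s \<in> S. \<forall>t \<in> T. \<not> s \<rightarrow>\<^bsub>G\<^esub> t)"

definition is_module :: "('a,'b) pre_digraph \<Rightarrow> 'a set \<Rightarrow> bool" where
  "is_module G S \<longleftrightarrow>
     S \<subseteq> verts G \<and> (\<forall>v \<in> verts G - S. complete_to G {v} S \<or> anticomplete_to G {v} S)"

text \<open>
  Since the graphs are symmetric, the components of an induced subgraph are its strongly connected
  components \<^const>\<open>pre_digraph.sccs\<close>.
\<close>

definition H_partition :: "('a,'b) pre_digraph \<Rightarrow> (nat \<Rightarrow> 'a set) \<Rightarrow> bool" where
  "H_partition G A \<longleftrightarrow>
     (\<Union>i \<in> {1..7}. A i) = verts G \<and> disjoint_family_on A {1..7} \<and> (\<forall>i \<in> {1..7}. A i \<noteq> {}) \<and>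
     complete_to G (A 1) (A 2 \<union> A 5 \<union> A 6) \<and> anticomplete_to G (A 1) (A 3 \<union> A 4 \<union> A 7) \<and>
     complete_to G (A 2) (A 1 \<union> A 3) \<and> anticomplete_to G (A 2) (A 4 \<union> A 5 \<union> A 6 \<union> A 7) \<and>
     complete_to G (A 3) (A 2 \<union> A 4 \<union> A 6) \<and> anticomplete_to G (A 3) (A 1 \<union> A 5 \<union> A 7) \<and>
     complete_to G (A 4) (A 3 \<union> A 5 \<union> A 6) \<and> anticomplete_to G (A 4) (A 1 \<union> A 2 \<union> A 7) \<and>
     complete_to G (A 5) (A 1 \<union> A 4) \<and> anticomplete_to G (A 5) (A 2 \<union> A 3 \<union> A 6 \<union> A 7) \<and>
     (\<forall>C \<in> pre_digraph.sccs (G \<restriction> A 7). is_module G (verts C)) \<and>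
     (\<forall>v \<in> A 7. \<exists>w \<in> A 6. v \<rightarrow>\<^bsub>G\<^esub> w)"

definition class_H :: "('a,'b) pre_digraph set" where
  "class_H = {G. graph G \<and> P5_gem_free G \<and> (\<exists>A. H_partition G A)}"

end

theory Submission
  imports Defs
begin

text \<open>
  Let \<open>N = k - 1\<close>. The gem-freeness makes \<open>A 1, \<dots>, A 5\<close> induce \<open>P\<^sub>4\<close>-free, hence perfect graphs:
  \<open>A i\<close> contains a clique of size \<open>w\<^sub>i\<close> and is \<open>w\<^sub>i\<close>-colourable. Colour \<open>G - v\<close> with \<open>N\<close> colours
  for some \<open>v \<in> A 7\<close>: no colour occurs in more than two of the five cliques, so
  \<open>w\<^sub>1 + \<dots> + w\<^sub>5 \<le> 2N\<close>, and \<open>w\<^sub>i + w\<^sub>j \<le> N\<close> for neighbouring \<open>A i\<close> and \<open>A j\<close>. Now colour \<open>G - v\<close>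
  with \<open>N\<close> colours for some \<open>v \<in> A 2\<close>: as \<open>A 1\<close>, \<open>A 3\<close>, \<open>A 4\<close> are intact, at most
  \<open>N - max w\<^sub>1 (w\<^sub>3 + w\<^sub>4)\<close> colours are used on \<open>A 6\<close>. Keep this colouring on \<open>A 6 \<union> A 7\<close>, and
  recolour \<open>A 1 \<union> A 3 \<union> A 4\<close> with \<open>max w\<^sub>1 (w\<^sub>3 + w\<^sub>4)\<close> colours not used on \<open>A 6\<close>; the inequalities
  allow the palette of \<open>A 1\<close> to overlap those of \<open>A 3\<close> and \<open>A 4\<close> so that enough colours remain
  for \<open>A 2\<close> and \<open>A 5\<close>. Hence \<open>G\<close> is \<open>N\<close>-colourable.
\<close>

section \<open>Perfection of P_4-free graphs\<close>

text \<open>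
  Among the proper colourings one minimizing the sum of the colours is taken; every vertex then has
  neighbours of all smaller colours. A clique on the colours \<open>{i..<n}\<close> extends to colour \<open>i - 1\<close>:
  otherwise a vertex of this colour with the most neighbours in the clique starts an induced \<open>P\<^sub>4\<close>.
\<close>

lemma P4_free_perfect:
  fixes R :: "'a \<Rightarrow> 'a \<Rightarrow> bool"
  assumes fin: "finite S"
    and sym: "\<And>u v. R u v \<Longrightarrow> R v u"
    and irrefl: "\<And>u. \<not> R u u"
    and P4_free: "\<And>a b c d. \<lbrakk>a \<in> S; b \<in> S; c \<in> S; d \<in> S; R a b; R b c; R c d\<rbrakk>
                    \<Longrightarrow> R a c \<or> R a d \<or> R b d"
  obtains W f where "W \<subseteq> S" "pairwise R W" "f ` S \<subseteq> {..<card W}"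
    "\<And>u v. u \<in> S \<Longrightarrow> v \<in> S \<Longrightarrow> R u v \<Longrightarrow> f u \<noteq> (f v :: nat)"
proof -
  define proper where "proper f \<longleftrightarrow> (\<forall>u\<in>S. \<forall>v\<in>S. R u v \<longrightarrow> f u \<noteq> f v)" for f :: "'a \<Rightarrow> nat"
  obtain f0 :: "'a \<Rightarrow> nat" where "inj_on f0 S"
    using finite_imp_inj_to_nat_seg[OF fin] by blast
  then have "proper f0"
    unfolding proper_def inj_on_def using irrefl by metis
  then obtain f where f: "proper f" and minimal: "\<And>g. proper g \<Longrightarrow> sum f S \<le> sum g S"
    using ex_has_least_nat[of proper f0 "\<lambda>g. sum g S"] by blast
  have smaller: "\<exists>u\<in>S. R u v \<and> f u = j" if v: "v \<in> S" and j: "j < f v" for v j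
  proof (rule ccontr)
    assume no: "\<not> ?thesis"
    have "proper (f(v := j))"
      using f no sym irrefl unfolding proper_def by (metis fun_upd_apply)
    moreover have "sum (f(v := j)) S < sum f S"
      using v j fin by (intro sum_strict_mono_ex1) auto
    ultimately show False
      using minimal by fastforce
  qed
  \<comment> \<open>\<open>Max\<close> is unspecified on the empty set; there \<open>n = 0\<close>
    lets the empty clique serve. Otherwise \<open>n - 1\<close> is the largest colour that occurs,
    which supplies the first vertex of the clique.\<close>
  define n where "n = (if S = {} then 0 else Suc (Max (f ` S)))"
  have bound: "f u < n" if "u \<in> S" for u
    using that fin by (auto simp: n_def less_Suc_eq_le)
  \<comment> \<open>\<open>Q\<close> carries the \<open>m\<close> largest colours, one vertex for
    each, so \<open>m = n\<close> yields a clique with as many vertices as there are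
    colours.\<close>
  have "\<exists>Q \<subseteq> S. pairwise R Q \<and> bij_betw f Q {n - m..<n}" if "m \<le> n" for m
    using that
  proof (induction m)
    case 0
    then show ?case
      by (intro exI[of _ "{}"]) (auto simp: bij_betw_def)
  next
    case (Suc m)
    then obtain Q where Q: "Q \<subseteq> S" "pairwise R Q" "bij_betw f Q {n - m..<n}"
      by auto
    define i where "i = n - Suc m"
    have i: "n - m = Suc i" "i < n"
      using Suc.prems by (auto simp: i_def)
    have "finite Q"
      using Q(1) fin finite_subset by blast
    define T where "T = {v \<in> S. f v = i}"
    have "S \<noteq> {}"
      using i(2) by (auto simp: n_def)
    then have "Max (f ` S) \<in> f ` S" "n - 1 = Max (f ` S)"
      using fin by (auto simp: n_def intro: Max_in)
    then obtain t where t: "t \<in> S" "f t = n - 1"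
      by (metis imageE)
    have "T \<noteq> {}"
    proof (cases "i = n - 1")
      case False
      then show ?thesis
        using smaller[OF t(1), of i] t(2) i(2) unfolding T_def by fastforce
    qed (use t in \<open>auto simp: T_def\<close>)
    moreover have "finite T"
      using fin by (simp add: T_def)
    ultimately obtain v where v: "v \<in> T"
      and vmax: "\<And>w. w \<in> T \<Longrightarrow> card {q \<in> Q. R w q} \<le> card {q \<in> Q. R v q}"
      using Max_in[of "(\<lambda>w. card {q \<in> Q. R w q}) ` T"]
        Max_ge[of "(\<lambda>w. card {q \<in> Q. R w q}) ` T"]
      by (smt (verit, best) finite_imageI image_iff image_is_empty)
    have "R v u" if u: "u \<in> Q" for u
    proof (rule ccontr)
      assume nvu: "\<not> R v u"
      have "f u > i"
        using bij_betwE[OF Q(3)] u i(1) by auto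
      then obtain w where w: "w \<in> T" "R w u"
        using smaller[of u i] u Q(1) by (auto simp: T_def)
      \<comment> \<open>Since \<open>w\<close> sees \<open>u\<close> and \<open>v\<close> does not,
        maximality of \<open>v\<close> forces some \<open>x\<close> in \<open>Q\<close> that
        \<open>v\<close> sees and \<open>w\<close> does not. Then \<open>v\<close>,
        \<open>x\<close>, \<open>u\<close>, \<open>w\<close> is an induced path, as \<open>v\<close>
        and \<open>w\<close> share the colour \<open>i\<close>.\<close>
      have "\<not> {q \<in> Q. R v q} \<subseteq> {q \<in> Q. R w q}"
      proof
        assume "{q \<in> Q. R v q} \<subseteq> {q \<in> Q. R w q}"
        then have "{q \<in> Q. R v q} \<subset> {q \<in> Q. R w q}"
          using u w nvu by blast
        then have "card {q \<in> Q. R v q} < card {q \<in> Q. R w q}"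
          using \<open>finite Q\<close> by (intro psubset_card_mono) auto
        then show False
          using vmax[OF w(1)] by linarith
      qed
      then obtain x where x: "x \<in> Q" "R v x" "\<not> R w x"
        by blast
      have "R x u"
        using Q(2) x u nvu by (auto simp: pairwise_def)
      moreover have "\<not> R v w"
        using f v w(1) unfolding proper_def T_def by force
      ultimately show False
        using P4_free[of v x u w] v w x u Q(1) nvu sym[of x w] sym[of w u] sym[of w x]
        unfolding T_def by blast
    qed
    moreover have "v \<in> S" "f v = i"
      using v by (auto simp: T_def)
    moreover have "{n - Suc m..<n} = insert i {n - m..<n}"
      using i by (auto simp: i_def)
    moreover have "i \<notin> {n - m..<n}"
      using i by auto
    then have "bij_betw f (insert v Q) (insert i {n - m..<n})"
      using Q(3) \<open>f v = i\<close> by (auto simp: bij_betw_def)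
    moreover have "pairwise R (insert v Q)"
      using Q(2) calculation(1) sym by (auto simp: pairwise_insert)
    ultimately show ?case
      using Q(1) by (intro exI[of _ "insert v Q"]) simp
  qed
  from this[of n] obtain Q where "Q \<subseteq> S" "pairwise R Q" "bij_betw f Q {..<n}"
    by (auto simp: atLeast0LessThan)
  moreover from this have "card Q = n"
    using bij_betw_same_card[of f Q "{..<n}"] by simp
  ultimately show thesis
    using that[of Q f] bound f unfolding proper_def by blast
qed

section \<open>Forbidden gems and palettes of neighbourhoods\<close>

text \<open>The inverse of \<open>p\<close> is an isomorphism from the subgraph induced by the image
  of \<open>p\<close> onto \<open>F\<close>. It is bijective on arcs because \<open>G\<close> has no
  parallel arcs and \<open>p\<close> both preserves and reflects adjacency.\<close>

lemma (in graph) contains_inducedI: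
  fixes F :: "'c pair_pre_digraph"
  assumes p: "inj_on p (pverts F)" "p ` pverts F \<subseteq> verts G"
    and F: "parcs F \<subseteq> pverts F \<times> pverts F"
    and arcs: "\<And>i j. i \<in> pverts F \<Longrightarrow> j \<in> pverts F \<Longrightarrow> p i \<rightarrow>\<^bsub>G\<^esub> p j \<longleftrightarrow> (i, j) \<in> parcs F"
  shows "contains_induced G (with_proj F)"
proof -
  let ?H = "G \<restriction> (p ` pverts F)"
  define q where "q = the_inv_into (pverts F) p"
  have q: "q (p i) = i" if "i \<in> pverts F" for i
    unfolding q_def using the_inv_into_f_f[OF p(1) that] .
  \<comment> \<open>Arcs of \<open>F\<close> are pairs of vertices, so an arc goes to the pair of
    preimages of its ends, with \<open>fst\<close> and \<open>snd\<close> as the new tail and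
    head.\<close>
  define h where "h = \<lparr> iso_verts = q, iso_arcs = (\<lambda>e. (q (tail G e), q (head G e))),
    iso_head = snd, iso_tail = fst \<rparr>"
  have H: "induced_subgraph ?H G"
    using p(2) by (rule induced_induce)
  then interpret H: wf_digraph ?H
    by (simp add: induced_subgraph_def subgraph_def)
  have inj: "inj_on (\<lambda>e. (q (tail G e), q (head G e))) (arcs ?H)"
  proof (rule inj_onI)
    fix d e
    assume "d \<in> arcs ?H" "e \<in> arcs ?H"
      and "(q (tail G d), q (head G d)) = (q (tail G e), q (head G e))"
    then have "tail G d = tail G e" "head G d = head G e" "d \<in> arcs G" "e \<in> arcs G"
      using q by auto
    then show "d = e"
      using no_multi_arcs by (simp add: arc_to_ends_def)
  qed
  have img: "(\<lambda>e. (q (tail G e), q (head G e))) ` arcs ?H = parcs F"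
  proof (intro set_eqI iffI)
    fix x assume "x \<in> (\<lambda>e. (q (tail G e), q (head G e))) ` arcs ?H"
    then obtain e i j where e: "e \<in> arcs G" "tail G e = p i" "head G e = p j"
      "i \<in> pverts F" "j \<in> pverts F" "x = (i, j)"
      using q by auto
    then have "p i \<rightarrow>\<^bsub>G\<^esub> p j"
      using in_arcs_imp_in_arcs_ends by metis
    then show "x \<in> parcs F"
      using arcs e by blast
  next
    fix x assume x: "x \<in> parcs F"
    then obtain i j where ij: "x = (i, j)" "i \<in> pverts F" "j \<in> pverts F"
      using F by blast
    then have "p i \<rightarrow>\<^bsub>G\<^esub> p j"
      using arcs x by blast
    then obtain e where "e \<in> arcs G" "tail G e = p i" "head G e = p j"
      by (auto simp: arcs_ends_def arc_to_ends_def)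
    then show "x \<in> (\<lambda>e. (q (tail G e), q (head G e))) ` arcs ?H"
      using ij q by (intro image_eqI[of _ _ e]) auto
  qed
  have "H.digraph_isomorphism h"
    unfolding H.digraph_isomorphism_def
    using inj q H.wf_digraph by (auto simp: h_def inj_on_def)
  moreover have "with_proj F = app_iso h ?H"
    using img q by (simp add: app_iso_def h_def with_proj_def image_image)
  ultimately show ?thesis
    unfolding contains_induced_def digraph_iso_def using H by blast
qed

text \<open>A chordless path \<open>a\<close>, \<open>b\<close>, \<open>c\<close>, \<open>d\<close>
  together with the common neighbour \<open>v\<close>, in the role of vertex 4, would induce a
  gem.\<close>

lemma (in graph) gem_free_neighbourhood_P4_free:
  assumes free: "P5_gem_free G" and vS: "\<And>s. s \<in> S \<Longrightarrow> v \<rightarrow>\<^bsub>G\<^esub> s"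
    and abcd: "a \<in> S" "b \<in> S" "c \<in> S" "d \<in> S" "a \<rightarrow>\<^bsub>G\<^esub> b" "b \<rightarrow>\<^bsub>G\<^esub> c" "c \<rightarrow>\<^bsub>G\<^esub> d"
  shows "a \<rightarrow>\<^bsub>G\<^esub> c \<or> a \<rightarrow>\<^bsub>G\<^esub> d \<or> b \<rightarrow>\<^bsub>G\<^esub> d"
proof (rule ccontr)
  assume no: "\<not> ?thesis"
  have sym: "x \<rightarrow>\<^bsub>G\<^esub> y \<longleftrightarrow> y \<rightarrow>\<^bsub>G\<^esub> x" for x y
    using graph_symmetric by blast
  have irrefl: "\<not> x \<rightarrow>\<^bsub>G\<^esub> x" for x
    using adj_not_same by blast
  have adj: "v \<rightarrow>\<^bsub>G\<^esub> a" "v \<rightarrow>\<^bsub>G\<^esub> b" "v \<rightarrow>\<^bsub>G\<^esub> c" "v \<rightarrow>\<^bsub>G\<^esub> d"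
    using vS abcd by auto
  define p where "p = (!) [a, b, c, d, v]"
  have p: "p 0 = a" "p 1 = b" "p (Suc 0) = b" "p 2 = c" "p 3 = d" "p 4 = v"
    by (auto simp: p_def)
  have pv: "pverts gem = {0, 1, 2, 3, 4}"
    by (simp add: gem_def path_graph_def lessThan_nat_numeral lessThan_Suc insert_commute)
  have pa: "(i, j) \<in> parcs gem \<longleftrightarrow>
      i < 4 \<and> j < 4 \<and> (j = Suc i \<or> i = Suc j) \<or> i < 4 \<and> j = 4 \<or> i = 4 \<and> j < 4" for i j
    by (simp add: gem_def path_graph_def)
  have "a \<noteq> b" "b \<noteq> c" "c \<noteq> d" "a \<noteq> v" "b \<noteq> v" "c \<noteq> v" "d \<noteq> v"
    using abcd adj adj_not_same by blast+
  \<comment> \<open>An equality here would turn an edge of the path into an excluded chord: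
    \<open>a = c\<close>, for instance, makes the edge from \<open>c\<close> to \<open>d\<close> one
    from \<open>a\<close> to \<open>d\<close>.\<close>
  moreover have "a \<noteq> c" "a \<noteq> d" "b \<noteq> d"
    using no abcd sym by blast+
  ultimately have neq: "distinct [a, b, c, d, v]"
    by simp
  have "contains_induced G (with_proj gem)"
  proof (rule contains_inducedI)
    show "inj_on p (pverts gem)"
      using neq by (simp add: pv p inj_on_def) blast
    show "p ` pverts gem \<subseteq> verts G"
      using adj adj_in_verts by (auto simp: pv p)
    show "parcs gem \<subseteq> pverts gem \<times> pverts gem"
      by (auto simp: gem_def path_graph_def)
    show "p i \<rightarrow>\<^bsub>G\<^esub> p j \<longleftrightarrow> (i, j) \<in> parcs gem" if "i \<in> pverts gem" "j \<in> pverts gem" for i j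
    proof -
      have "\<not> a \<rightarrow>\<^bsub>G\<^esub> c" "\<not> c \<rightarrow>\<^bsub>G\<^esub> a" "\<not> a \<rightarrow>\<^bsub>G\<^esub> d" "\<not> d \<rightarrow>\<^bsub>G\<^esub> a" "\<not> b \<rightarrow>\<^bsub>G\<^esub> d" "\<not> d \<rightarrow>\<^bsub>G\<^esub> b"
        "b \<rightarrow>\<^bsub>G\<^esub> a" "c \<rightarrow>\<^bsub>G\<^esub> b" "d \<rightarrow>\<^bsub>G\<^esub> c" "a \<rightarrow>\<^bsub>G\<^esub> v" "b \<rightarrow>\<^bsub>G\<^esub> v" "c \<rightarrow>\<^bsub>G\<^esub> v" "d \<rightarrow>\<^bsub>G\<^esub> v"
        using no abcd adj sym by blast+
      then show ?thesis
        using that(1)[unfolded pv] that(2)[unfolded pv] abcd(5-7) adj irrefl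
        by (elim insertE emptyE) (simp_all add: p pa)
    qed
  qed
  then show False
    using free by (simp add: P5_gem_free_def)
qed

text \<open>\<open>P4_free_perfect\<close> colours \<open>S\<close> with \<open>card W\<close>
  colours; composing with a bijection moves this colouring to any palette \<open>Y\<close> of that
  size. The freedom to choose \<open>Y\<close> is what the recolouring of \<open>A 1\<close>, ...,
  \<open>A 5\<close> relies on.\<close>

lemma (in graph) neighbourhood_clique_palette:
  assumes "P5_gem_free G" and S: "S \<subseteq> verts G" and v: "\<And>s. s \<in> S \<Longrightarrow> v \<rightarrow>\<^bsub>G\<^esub> s"
  obtains W where "W \<subseteq> S" "pairwise (\<lambda>x y. x \<rightarrow>\<^bsub>G\<^esub> y) W" "finite W"
    "\<And>Y. finite Y \<Longrightarrow> card Y = card W \<Longrightarrow>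
       \<exists>g :: 'a \<Rightarrow> nat. g ` S \<subseteq> Y \<and> (\<forall>x\<in>S. \<forall>y\<in>S. x \<rightarrow>\<^bsub>G\<^esub> y \<longrightarrow> g x \<noteq> g y)"
proof -
  have fin: "finite S"
    using S finite_subset finite_verts by blast
  obtain W and f :: "'a \<Rightarrow> nat" where W: "W \<subseteq> S" "pairwise (\<lambda>x y. x \<rightarrow>\<^bsub>G\<^esub> y) W"
    and f: "f ` S \<subseteq> {..<card W}"
      "\<And>x y. x \<in> S \<Longrightarrow> y \<in> S \<Longrightarrow> x \<rightarrow>\<^bsub>G\<^esub> y \<Longrightarrow> f x \<noteq> f y"
  proof (rule P4_free_perfect[of S "\<lambda>x y. x \<rightarrow>\<^bsub>G\<^esub> y"])
    show "finite S"
      by (fact fin)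
    show "y \<rightarrow>\<^bsub>G\<^esub> x" if "x \<rightarrow>\<^bsub>G\<^esub> y" for x y
      using that by (rule graph_symmetric)
    show "\<not> x \<rightarrow>\<^bsub>G\<^esub> x" for x
      using adj_not_same by blast
    show "a \<rightarrow>\<^bsub>G\<^esub> c \<or> a \<rightarrow>\<^bsub>G\<^esub> d \<or> b \<rightarrow>\<^bsub>G\<^esub> d"
      if "a \<in> S" "b \<in> S" "c \<in> S" "d \<in> S" "a \<rightarrow>\<^bsub>G\<^esub> b" "b \<rightarrow>\<^bsub>G\<^esub> c" "c \<rightarrow>\<^bsub>G\<^esub> d" for a b c d
      using gem_free_neighbourhood_P4_free[OF assms(1) v that] .
  qed (rule that)
  show thesis
  proof (rule that[OF W])
    show "finite W"
      using W(1) fin finite_subset by blast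
    fix Y :: "nat set"
    assume "finite Y" "card Y = card W"
    then obtain h where h: "bij_betw h {..<card W} Y"
      using bij_betw_iff_card[of "{..<card W}" Y] by auto
    have "(h \<circ> f) ` S \<subseteq> Y"
      using f(1) h by (auto simp: bij_betw_def)
    moreover have "(h \<circ> f) x \<noteq> (h \<circ> f) y" if "x \<in> S" "y \<in> S" "x \<rightarrow>\<^bsub>G\<^esub> y" for x y
      using f(1) f(2)[OF that] that(1,2) h
      by (auto simp: bij_betw_def dest!: inj_onD)
    ultimately show "\<exists>g. g ` S \<subseteq> Y \<and> (\<forall>x\<in>S. \<forall>y\<in>S. x \<rightarrow>\<^bsub>G\<^esub> y \<longrightarrow> g x \<noteq> g y)"
      by blast
  qed
qed

section \<open>Counting colours around a pentagon\<close>

text \<open>\<open>F\<close> stands for the colours on \<open>A 6\<close>, which only the palettes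
  of \<open>A 1\<close>, \<open>A 3\<close>, \<open>A 4\<close> must avoid. \<open>Y1\<close>
  overlaps \<open>Y3\<close> and \<open>Y4\<close> as much as possible, so that the three fit
  outside \<open>F\<close>; the overlap is split so that \<open>Y2\<close> fits outside
  \<open>Y1\<close> and \<open>Y3\<close>, and \<open>Y5\<close> outside \<open>Y1\<close> and
  \<open>Y4\<close>.\<close>

lemma pentagon_palettes:
  fixes U F :: "'a set"
  assumes U: "finite U" "F \<subseteq> U" "N = card U"
    and edges: "w1 + w2 \<le> N" "w2 + w3 \<le> N" "w4 + w5 \<le> N" "w5 + w1 \<le> N"
    and total: "w1 + w2 + w3 + w4 + w5 \<le> 2 * N"
    and F: "w1 + card F \<le> N" "w3 + w4 + card F \<le> N"
  obtains Y1 Y2 Y3 Y4 Y5 where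
    "Y1 \<subseteq> U" "Y2 \<subseteq> U" "Y3 \<subseteq> U" "Y4 \<subseteq> U" "Y5 \<subseteq> U"
    "card Y1 = w1" "card Y2 = w2" "card Y3 = w3" "card Y4 = w4" "card Y5 = w5"
    "Y1 \<inter> Y2 = {}" "Y2 \<inter> Y3 = {}" "Y3 \<inter> Y4 = {}" "Y4 \<inter> Y5 = {}" "Y5 \<inter> Y1 = {}"
    "Y1 \<inter> F = {}" "Y3 \<inter> F = {}" "Y4 \<inter> F = {}"
proof -
  \<comment> \<open>\<open>i\<close> and \<open>j\<close> will be the sizes of
    \<open>Y1 \<inter> Y3\<close> and \<open>Y1 \<inter> Y4\<close>; the last two inequalities leave
    room for \<open>Y2\<close> and \<open>Y5\<close>.\<close>
  have "\<exists>i j. i \<le> w3 \<and> j \<le> w4 \<and> i + j = min w1 (w3 + w4) \<and>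
      w1 + w2 + w3 \<le> N + i \<and> w1 + w4 + w5 \<le> N + j"
  proof -
    define m where "m = min w1 (w3 + w4)"
    \<comment> \<open>The least overlap with \<open>Y4\<close> that leaves room for
      \<open>Y5\<close>; truncated subtraction gives 0 when none is required.\<close>
    define j0 where "j0 = w1 + w4 + w5 - N"
    have m: "m \<le> w1" "m \<le> w3 + w4" "m = w1 \<or> m = w3 + w4"
      by (auto simp: m_def)
    have j0: "w1 + w4 + w5 \<le> N + j0" "j0 = 0 \<or> w1 + w4 + w5 = N + j0" "j0 \<le> w4" "j0 \<le> w1"
      using edges by (auto simp: j0_def)
    show ?thesis
    proof (cases "w3 + j0 \<le> m")
      case True
      then show ?thesis
        unfolding m_def[symmetric] using m j0 edges
        by (intro exI[of _ w3] exI[of _ "m - w3"]) linarith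
    \<comment> \<open>Here \<open>m = w1\<close>, because \<open>j0 \<le> w4\<close> excludes
      \<open>m = w3 + w4\<close>. With the overlap with \<open>Y4\<close> kept at its minimum
      \<open>j0\<close>, room for \<open>Y2\<close> follows from \<open>total\<close> if
      \<open>j0 > 0\<close> and from \<open>w2 + w3 \<le> N\<close> otherwise.\<close>
    next
      case False
      then show ?thesis
        unfolding m_def[symmetric] using m j0 edges total
        by (intro exI[of _ "m - j0"] exI[of _ j0]) linarith
    qed
  qed
  then obtain i j where ij: "i \<le> w3" "j \<le> w4" "i + j = min w1 (w3 + w4)"
    "w1 + w2 + w3 \<le> N + i" "w1 + w4 + w5 \<le> N + j"
    by blast
  have fin: "finite X" if "X \<subseteq> U" for X
    using that U(1) finite_subset by blast
  have cardF: "card (U - F) = N - card F"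
    using U fin card_Diff_subset by metis
  have "w3 \<le> card (U - F)"
    using F cardF by linarith
  then obtain Y3 where Y3: "Y3 \<subseteq> U - F" "card Y3 = w3"
    using obtain_subset_with_card_n by metis
  have c3: "card (U - F - Y3) = N - card F - w3"
    using Y3 cardF fin[of Y3] card_Diff_subset[of Y3 "U - F"] by (simp add: subset_iff)
  have "w4 \<le> card (U - F - Y3)"
    using F c3 by linarith
  then obtain Y4 where Y4: "Y4 \<subseteq> U - F - Y3" "card Y4 = w4"
    using obtain_subset_with_card_n by metis
  have c4: "card (U - F - Y3 - Y4) = N - card F - w3 - w4"
    using Y4 c3 fin[of Y4] card_Diff_subset[of Y4 "U - F - Y3"] by (simp add: subset_iff)
  obtain I where I: "I \<subseteq> Y3" "card I = i"
    using obtain_subset_with_card_n ij(1) Y3(2) by metis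
  obtain J where J: "J \<subseteq> Y4" "card J = j"
    using obtain_subset_with_card_n ij(2) Y4(2) by metis
  \<comment> \<open>\<open>L\<close> is non-empty only if \<open>w1 > w3 + w4\<close>; then
    \<open>Y3\<close> and \<open>Y4\<close> are used up entirely, and
    \<open>w1 + card F \<le> N\<close> provides the rest.\<close>
  have "w1 - (i + j) \<le> card (U - F - Y3 - Y4)"
    using ij F unfolding c4 by linarith
  then obtain L where L: "L \<subseteq> U - F - Y3 - Y4" "card L = w1 - (i + j)"
    using obtain_subset_with_card_n by metis
  define Y1 where "Y1 = I \<union> J \<union> L"
  have sub: "I \<subseteq> U" "J \<subseteq> U" "L \<subseteq> U" "Y3 \<subseteq> U" "Y4 \<subseteq> U"
    using I J L Y3 Y4 by blast+
  have Y1: "Y1 \<subseteq> U" "Y1 \<inter> F = {}" "Y1 \<inter> Y3 = I" "Y1 \<inter> Y4 = J"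
    using I J L Y3 Y4 unfolding Y1_def by blast+
  have "card (I \<union> J) = i + j"
    using I J Y4 sub fin card_Un_disjoint[of I J] by blast
  moreover have "card Y1 = card (I \<union> J) + card L"
    unfolding Y1_def using I J L sub fin by (intro card_Un_disjoint) auto
  ultimately have cY1: "card Y1 = w1"
    using L(2) ij(3) by linarith
  have "card (Y1 \<union> Y3) + i = w1 + w3"
    using card_Un_Int[of Y1 Y3] fin Y1 sub I Y3 cY1 by simp
  moreover have "card (U - (Y1 \<union> Y3)) = N - card (Y1 \<union> Y3)"
    using U(3) fin[of "Y1 \<union> Y3"] Y1(1) sub card_Diff_subset[of "Y1 \<union> Y3" U] by blast
  ultimately have "w2 \<le> card (U - (Y1 \<union> Y3))"
    using ij by linarith
  then obtain Y2 where Y2: "Y2 \<subseteq> U - (Y1 \<union> Y3)" "card Y2 = w2"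
    using obtain_subset_with_card_n by metis
  have "card (Y1 \<union> Y4) + j = w1 + w4"
    using card_Un_Int[of Y1 Y4] fin Y1 sub J Y4 cY1 by simp
  moreover have "card (U - (Y1 \<union> Y4)) = N - card (Y1 \<union> Y4)"
    using U(3) fin[of "Y1 \<union> Y4"] Y1(1) sub card_Diff_subset[of "Y1 \<union> Y4" U] by blast
  ultimately have "w5 \<le> card (U - (Y1 \<union> Y4))"
    using ij by linarith
  then obtain Y5 where Y5: "Y5 \<subseteq> U - (Y1 \<union> Y4)" "card Y5 = w5"
    using obtain_subset_with_card_n by metis
  show thesis
    by (rule that[of Y1 Y2 Y3 Y4 Y5]) (use Y1 Y2 Y3 Y4 Y5 cY1 sub in blast)+
qed

text \<open>Three of the five sets always include two cyclically consecutive ones, so each element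
  of \<open>U\<close> lies in at most two of the sets. Summing indicators over \<open>U\<close>
  gives the bound.\<close>

lemma pentagon_sum_card_le:
  fixes X1 :: "'a set"
  assumes fin: "finite U" and sub: "X1 \<subseteq> U" "X2 \<subseteq> U" "X3 \<subseteq> U" "X4 \<subseteq> U" "X5 \<subseteq> U"
    and disj: "X1 \<inter> X2 = {}" "X2 \<inter> X3 = {}" "X3 \<inter> X4 = {}" "X4 \<inter> X5 = {}" "X5 \<inter> X1 = {}"
  shows "card X1 + card X2 + card X3 + card X4 + card X5 \<le> 2 * card U"
proof -
  have ind: "card X = (\<Sum>u\<in>U. of_bool (u \<in> X))" if "X \<subseteq> U" for X
  proof -
    have "U \<inter> {u. u \<in> X} = X"
      using that by blast
    then show ?thesis
      using fin by simp
  qed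
  have "card X1 + card X2 + card X3 + card X4 + card X5 =
    (\<Sum>u\<in>U. of_bool (u \<in> X1) + of_bool (u \<in> X2) + of_bool (u \<in> X3) + of_bool (u \<in> X4)
      + of_bool (u \<in> X5))"
    using sub by (simp add: ind sum.distrib del: sum_of_bool_eq)
  also have "\<dots> \<le> (\<Sum>u\<in>U. 2)"
    using disj by (intro sum_mono) (auto simp: of_bool_def)
  finally show ?thesis
    by simp
qed

section \<open>Colourings of vertex-critical graphs\<close>

lemma (in graph) colourable_card_verts: "colourable G (card (verts G))"
proof -
  obtain f :: "'a \<Rightarrow> nat" where f: "f ` verts G = {i. i < card (verts G)}" "inj_on f (verts G)"
    using finite_imp_inj_to_nat_seg[OF finite_verts] by (metis card_Collect_less_nat card_image)
  then have "proper_colouring G (card (verts G)) f"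
    unfolding proper_colouring_def using adj_not_same by (auto dest: inj_onD)
  then show ?thesis
    by (auto simp: colourable_def)
qed

lemma colourable_mono: "colourable G m \<Longrightarrow> m \<le> n \<Longrightarrow> colourable G n"
  unfolding colourable_def proper_colouring_def using order_less_le_trans by blast

text \<open>Restates the colouring of the graph without \<open>v\<close> through adjacency in
  \<open>G\<close>, so that later arguments stay inside \<open>G\<close>.\<close>

lemma (in graph) vertex_critical_del_colouring:
  assumes "vertex_critical k G" "v \<in> verts G"
  obtains c where "\<And>u. u \<in> verts G - {v} \<Longrightarrow> c u < k - 1"
    "\<And>x y. x \<in> verts G - {v} \<Longrightarrow> y \<in> verts G - {v} \<Longrightarrow> x \<rightarrow>\<^bsub>G\<^esub> y \<Longrightarrow> c x \<noteq> c y"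
proof -
  let ?H = "pre_digraph.del_vert G v"
  have sub: "x \<in> verts G - {v} \<Longrightarrow> y \<in> verts G - {v} \<Longrightarrow> x \<rightarrow>\<^bsub>G\<^esub> y \<Longrightarrow> x \<rightarrow>\<^bsub>?H\<^esub> y" for x y
    by (auto simp: arcs_ends_def arc_to_ends_def del_vert_simps)
  have sup: "x \<rightarrow>\<^bsub>?H\<^esub> y \<Longrightarrow> x \<rightarrow>\<^bsub>G\<^esub> y" for x y
    by (auto simp: arcs_ends_def arc_to_ends_def del_vert_simps)
  \<comment> \<open>This crude colouring only ensures that the \<open>LEAST\<close> in
    \<open>chromatic_number\<close> is attained.\<close>
  obtain c where "proper_colouring G (card (verts G)) c"
    using colourable_card_verts by (auto simp: colourable_def)
  then have "proper_colouring ?H (card (verts G)) c"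
    using sup by (auto simp: proper_colouring_def verts_del_vert)
  then have "colourable ?H (card (verts G))"
    by (auto simp: colourable_def)
  then have "colourable ?H (chromatic_number ?H)"
    unfolding chromatic_number_def by (rule LeastI)
  moreover have "chromatic_number ?H \<le> k - 1"
    using assms unfolding vertex_critical_def by fastforce
  ultimately obtain c where "proper_colouring ?H (k - 1) c"
    using colourable_mono unfolding colourable_def by blast
  then have c: "c u < k - 1" "u \<rightarrow>\<^bsub>?H\<^esub> w \<Longrightarrow> c u \<noteq> c w"
    if "u \<in> verts G - {v}" "w \<in> verts G - {v}" for u w
    using that by (simp_all add: proper_colouring_def verts_del_vert)
  show thesis
    by (rule that[of c]) (use c sub in simp_all)
qed

lemma vertex_critical_not_colourable:
  assumes "vertex_critical k G" "k \<ge> 1"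
  shows "\<not> colourable G (k - 1)"
proof
  assume "colourable G (k - 1)"
  then have "chromatic_number G \<le> k - 1"
    unfolding chromatic_number_def by (rule Least_le)
  then show False
    using assms by (auto simp: vertex_critical_def)
qed

lemma (in graph) inj_on_clique:
  assumes "pairwise (\<lambda>x y. x \<rightarrow>\<^bsub>G\<^esub> y) W" "W \<subseteq> X"
    and "\<And>x y. x \<in> X \<Longrightarrow> y \<in> X \<Longrightarrow> x \<rightarrow>\<^bsub>G\<^esub> y \<Longrightarrow> c x \<noteq> c y"
  shows "inj_on c W"
proof (rule inj_onI, rule ccontr)
  fix x y
  assume xy: "x \<in> W" "y \<in> W" "c x = c y" "x \<noteq> y"
  then have "x \<rightarrow>\<^bsub>G\<^esub> y"
    using assms(1) by (auto simp: pairwise_def)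
  then show False
    using assms(2) assms(3)[of x y] xy by auto
qed

section \<open>Recolouring a graph of the class\<close>

theorem theorem2p9:
  fixes G :: "('a, 'b) pre_digraph" and k :: nat
  assumes "G \<in> class_H" and "k \<ge> 1"
  shows "\<not> vertex_critical k G"
proof
  assume crit: "vertex_critical k G"
  obtain A where "graph G" and free: "P5_gem_free G" and A: "H_partition G A"
    using assms(1) by (auto simp: class_H_def)
  interpret graph G
    by fact
  define N where "N = k - 1"
  have sym: "y \<rightarrow>\<^bsub>G\<^esub> x" if "x \<rightarrow>\<^bsub>G\<^esub> y" for x y
    using that by (rule graph_symmetric)
  have union: "(\<Union>i\<in>{1..7}. A i) = verts G"
    and disjoint: "disjoint_family_on A {1..7}"
    and nonempty: "\<And>i. i \<in> {1..7} \<Longrightarrow> A i \<noteq> {}"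
    using A unfolding H_partition_def by blast+
  have part: "i = j" if "x \<in> A i" "x \<in> A j" "i \<in> {1..7}" "j \<in> {1..7}" for x i j
    using disjoint that unfolding disjoint_family_on_def by blast
  have sub: "A i \<subseteq> verts G" if "i \<in> {1..7}" for i
    using union that by blast
  have adj: "\<And>x y. x \<in> A 1 \<Longrightarrow> y \<in> A 2 \<Longrightarrow> x \<rightarrow>\<^bsub>G\<^esub> y"
    "\<And>x y. x \<in> A 1 \<Longrightarrow> y \<in> A 5 \<Longrightarrow> x \<rightarrow>\<^bsub>G\<^esub> y"
    "\<And>x y. x \<in> A 1 \<Longrightarrow> y \<in> A 6 \<Longrightarrow> x \<rightarrow>\<^bsub>G\<^esub> y"
    "\<And>x y. x \<in> A 2 \<Longrightarrow> y \<in> A 3 \<Longrightarrow> x \<rightarrow>\<^bsub>G\<^esub> y"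
    "\<And>x y. x \<in> A 3 \<Longrightarrow> y \<in> A 4 \<Longrightarrow> x \<rightarrow>\<^bsub>G\<^esub> y"
    "\<And>x y. x \<in> A 3 \<Longrightarrow> y \<in> A 6 \<Longrightarrow> x \<rightarrow>\<^bsub>G\<^esub> y"
    "\<And>x y. x \<in> A 4 \<Longrightarrow> y \<in> A 5 \<Longrightarrow> x \<rightarrow>\<^bsub>G\<^esub> y"
    "\<And>x y. x \<in> A 4 \<Longrightarrow> y \<in> A 6 \<Longrightarrow> x \<rightarrow>\<^bsub>G\<^esub> y"
    using A unfolding H_partition_def complete_to_def by blast+
  have nonadj: "\<And>x y. x \<in> A 1 \<Longrightarrow> y \<in> A 3 \<Longrightarrow> \<not> x \<rightarrow>\<^bsub>G\<^esub> y"
    "\<And>x y. x \<in> A 1 \<Longrightarrow> y \<in> A 4 \<Longrightarrow> \<not> x \<rightarrow>\<^bsub>G\<^esub> y"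
    "\<And>x y. x \<in> A 1 \<Longrightarrow> y \<in> A 7 \<Longrightarrow> \<not> x \<rightarrow>\<^bsub>G\<^esub> y"
    "\<And>x y. x \<in> A 2 \<Longrightarrow> y \<in> A 4 \<Longrightarrow> \<not> x \<rightarrow>\<^bsub>G\<^esub> y"
    "\<And>x y. x \<in> A 2 \<Longrightarrow> y \<in> A 5 \<Longrightarrow> \<not> x \<rightarrow>\<^bsub>G\<^esub> y"
    "\<And>x y. x \<in> A 2 \<Longrightarrow> y \<in> A 6 \<Longrightarrow> \<not> x \<rightarrow>\<^bsub>G\<^esub> y"
    "\<And>x y. x \<in> A 2 \<Longrightarrow> y \<in> A 7 \<Longrightarrow> \<not> x \<rightarrow>\<^bsub>G\<^esub> y"
    "\<And>x y. x \<in> A 3 \<Longrightarrow> y \<in> A 5 \<Longrightarrow> \<not> x \<rightarrow>\<^bsub>G\<^esub> y"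
    "\<And>x y. x \<in> A 3 \<Longrightarrow> y \<in> A 7 \<Longrightarrow> \<not> x \<rightarrow>\<^bsub>G\<^esub> y"
    "\<And>x y. x \<in> A 4 \<Longrightarrow> y \<in> A 7 \<Longrightarrow> \<not> x \<rightarrow>\<^bsub>G\<^esub> y"
    "\<And>x y. x \<in> A 5 \<Longrightarrow> y \<in> A 6 \<Longrightarrow> \<not> x \<rightarrow>\<^bsub>G\<^esub> y"
    "\<And>x y. x \<in> A 5 \<Longrightarrow> y \<in> A 7 \<Longrightarrow> \<not> x \<rightarrow>\<^bsub>G\<^esub> y"
    using A unfolding H_partition_def anticomplete_to_def by blast+
  have palette: "\<exists>W. W \<subseteq> A i \<and> pairwise (\<lambda>x y. x \<rightarrow>\<^bsub>G\<^esub> y) W \<and> finite W \<and>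
      (\<forall>Y. finite Y \<longrightarrow> card Y = card W \<longrightarrow>
        (\<exists>g :: 'a \<Rightarrow> nat. g ` A i \<subseteq> Y \<and> (\<forall>x\<in>A i. \<forall>y\<in>A i. x \<rightarrow>\<^bsub>G\<^esub> y \<longrightarrow> g x \<noteq> g y)))"
    if i: "i \<in> {1..5}" for i
  proof -
    \<comment> \<open>A vertex complete to \<open>A i\<close> lies in a neighbouring part:
      \<open>a2\<close> serves \<open>A 1\<close> and \<open>A 3\<close>, \<open>a1\<close> serves
      \<open>A 2\<close> and \<open>A 5\<close>, and \<open>a3\<close> serves
      \<open>A 4\<close>.\<close>
    obtain v where "\<And>s. s \<in> A i \<Longrightarrow> v \<rightarrow>\<^bsub>G\<^esub> s"
    proof -
      have "i = 1 \<or> i = 2 \<or> i = 3 \<or> i = 4 \<or> i = 5"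
        using i by auto
      moreover obtain a1 a2 a3 where "a1 \<in> A 1" "a2 \<in> A 2" "a3 \<in> A 3"
        using nonempty[of 1] nonempty[of 2] nonempty[of 3] by auto
      ultimately show thesis
        using that adj sym by metis
    qed
    moreover have "A i \<subseteq> verts G"
      using sub i by auto
    ultimately show ?thesis
      using neighbourhood_clique_palette[OF free, of "A i" v] by metis
  qed
  then have "\<forall>i\<in>{1..5}. \<exists>W. W \<subseteq> A i \<and> pairwise (\<lambda>x y. x \<rightarrow>\<^bsub>G\<^esub> y) W \<and> finite W \<and>
      (\<forall>Y. finite Y \<longrightarrow> card Y = card W \<longrightarrow>
        (\<exists>g :: 'a \<Rightarrow> nat. g ` A i \<subseteq> Y \<and> (\<forall>x\<in>A i. \<forall>y\<in>A i. x \<rightarrow>\<^bsub>G\<^esub> y \<longrightarrow> g x \<noteq> g y)))"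
    by (rule ballI)
  from bchoice[OF this] obtain W where W_all:
    "\<forall>i\<in>{1..5}. W i \<subseteq> A i \<and> pairwise (\<lambda>x y. x \<rightarrow>\<^bsub>G\<^esub> y) (W i) \<and> finite (W i) \<and>
      (\<forall>Y. finite Y \<longrightarrow> card Y = card (W i) \<longrightarrow>
        (\<exists>g :: 'a \<Rightarrow> nat. g ` A i \<subseteq> Y \<and> (\<forall>x\<in>A i. \<forall>y\<in>A i. x \<rightarrow>\<^bsub>G\<^esub> y \<longrightarrow> g x \<noteq> g y)))"
    by (rule exE)
  have W: "W i \<subseteq> A i" "pairwise (\<lambda>x y. x \<rightarrow>\<^bsub>G\<^esub> y) (W i)" "finite (W i)"
    if "i \<in> {1..5}" for i
    using bspec[OF W_all that] by simp_all
  have recolour: "\<exists>g :: 'a \<Rightarrow> nat. g ` A i \<subseteq> Y \<and> (\<forall>x\<in>A i. \<forall>y\<in>A i. x \<rightarrow>\<^bsub>G\<^esub> y \<longrightarrow> g x \<noteq> g y)"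
    if "i \<in> {1..5}" "finite Y" "card Y = card (W i)" for i Y
    using bspec[OF W_all that(1)] that(2,3) by simp
  have W_sub: "W 1 \<subseteq> A 1" "W 2 \<subseteq> A 2" "W 3 \<subseteq> A 3" "W 4 \<subseteq> A 4" "W 5 \<subseteq> A 5"
    using W(1) by simp_all
  have mem_sub: "x \<in> verts G" if "x \<in> A i" "i \<in> {1..7}" for x i
    using sub that by blast

  \<comment> \<open>Deleting \<open>v7\<close> leaves the five cliques intact, and \<open>c\<close>
    injects each into the \<open>N\<close> colours. Consecutive cliques get disjoint colour sets,
    whence the inequalities on their sizes.\<close>
  obtain v7 where v7: "v7 \<in> A 7"
    using nonempty[of 7] by auto
  obtain c where c: "\<And>x. x \<in> verts G - {v7} \<Longrightarrow> c x < N"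
      "\<And>x y. x \<in> verts G - {v7} \<Longrightarrow> y \<in> verts G - {v7} \<Longrightarrow> x \<rightarrow>\<^bsub>G\<^esub> y \<Longrightarrow> c x \<noteq> c y"
    using vertex_critical_del_colouring[OF crit] mem_sub[OF v7] unfolding N_def by auto
  have ok7: "A i \<subseteq> verts G - {v7}" if "i \<in> {1..5}" for i
    using part[OF _ v7, of i] mem_sub[of _ i] that by fastforce
  have card7: "card (c ` W i) = card (W i)" "c ` W i \<subseteq> {..<N}" if "i \<in> {1..5}" for i
  proof -
    have "W i \<subseteq> verts G - {v7}"
      using W(1) ok7 that by blast
    then show "c ` W i \<subseteq> {..<N}"
      using c(1) by auto
    have "inj_on c (W i)"
      by (rule inj_on_clique[OF W(2)[OF that] \<open>W i \<subseteq> verts G - {v7}\<close>]) (rule c(2))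
    then show "card (c ` W i) = card (W i)"
      by (rule card_image)
  qed
  have disj7: "c ` W i \<inter> c ` W j = {}"
    if "\<And>x y. x \<in> A i \<Longrightarrow> y \<in> A j \<Longrightarrow> x \<rightarrow>\<^bsub>G\<^esub> y" "i \<in> {1..5}" "j \<in> {1..5}" for i j
  proof -
    have "c x \<noteq> c y" if "x \<in> W i" "y \<in> W j" for x y
      using that c(2)[of x y] \<open>\<And>x y. x \<in> A i \<Longrightarrow> y \<in> A j \<Longrightarrow> x \<rightarrow>\<^bsub>G\<^esub> y\<close>[of x y]
        W(1)[OF \<open>i \<in> {1..5}\<close>] W(1)[OF \<open>j \<in> {1..5}\<close>] ok7[OF \<open>i \<in> {1..5}\<close>] ok7[OF \<open>j \<in> {1..5}\<close>]
      by blast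
    then show ?thesis
      by blast
  qed
  have disj: "c ` W 1 \<inter> c ` W 2 = {}" "c ` W 2 \<inter> c ` W 3 = {}" "c ` W 3 \<inter> c ` W 4 = {}"
    "c ` W 4 \<inter> c ` W 5 = {}" "c ` W 5 \<inter> c ` W 1 = {}"
    using disj7[OF adj(1)] disj7[OF adj(4)] disj7[OF adj(5)] disj7[OF adj(7)]
      disj7[OF adj(2)] by (auto simp: Int_commute)
  have total: "card (W 1) + card (W 2) + card (W 3) + card (W 4) + card (W 5) \<le> 2 * N"
    using pentagon_sum_card_le[OF _ _ _ _ _ _ disj, of "{..<N}"] card7 by simp
  have edge: "card (W i) + card (W j) \<le> N"
    if "c ` W i \<inter> c ` W j = {}" "i \<in> {1..5}" "j \<in> {1..5}" for i j
  proof -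
    have "card (c ` W i \<union> c ` W j) = card (W i) + card (W j)"
      using card_Un_disjoint[OF _ _ that(1)] card7(1) W(3) that by simp
    moreover have "card (c ` W i \<union> c ` W j) \<le> card {..<N}"
      using card7(2) that by (intro card_mono) auto
    ultimately show ?thesis
      by simp
  qed

  \<comment> \<open>The colouring \<open>b\<close> is proper on \<open>A 6 \<union> A 7\<close>,
    where it is kept, and on \<open>A 1\<close>, \<open>A 3\<close>, \<open>A 4\<close>, whose
    cliques bound the number of colours on \<open>A 6\<close>.\<close>
  obtain v2 where v2: "v2 \<in> A 2"
    using nonempty[of 2] by auto
  obtain b where b: "\<And>x. x \<in> verts G - {v2} \<Longrightarrow> b x < N"
      "\<And>x y. x \<in> verts G - {v2} \<Longrightarrow> y \<in> verts G - {v2} \<Longrightarrow> x \<rightarrow>\<^bsub>G\<^esub> y \<Longrightarrow> b x \<noteq> b y"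
    using vertex_critical_del_colouring[OF crit] mem_sub[OF v2] unfolding N_def by auto
  have ok2: "A i \<subseteq> verts G - {v2}" if "i \<in> {1, 3, 4, 6, 7}" for i
    using part[OF _ v2, of i] mem_sub[of _ i] that by fastforce
  define F where "F = b ` A 6"
  have F: "F \<subseteq> {..<N}"
    using b(1) ok2[of 6] unfolding F_def by auto
  \<comment> \<open>A clique complete to \<open>A 6\<close> receives distinct colours outside
    \<open>F\<close>.\<close>
  have clique_F: "card B + card F \<le> N"
    if B: "B \<subseteq> verts G - {v2}" "pairwise (\<lambda>x y. x \<rightarrow>\<^bsub>G\<^esub> y) B"
      and BF: "\<And>x y. x \<in> B \<Longrightarrow> y \<in> A 6 \<Longrightarrow> x \<rightarrow>\<^bsub>G\<^esub> y" for B
  proof -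
    have "inj_on b B"
      by (rule inj_on_clique[OF B(2,1)]) (rule b(2))
    moreover have "b x \<noteq> b y" if "x \<in> B" "y \<in> A 6" for x y
      using b(2)[of x y] BF[OF that] that B(1) ok2[of 6] by blast
    then have "b ` B \<inter> F = {}"
      unfolding F_def by blast
    moreover have "b ` B \<subseteq> {..<N}"
      using b(1) B(1) by auto
    ultimately show ?thesis
      using F card_Un_disjoint[of "b ` B" F] card_mono[of "{..<N}" "b ` B \<union> F"]
      by (simp add: card_image finite_subset)
  qed
  have F1: "card (W 1) + card F \<le> N"
    using W(2)[of 1] W_sub ok2[of 1] adj(3) by (intro clique_F) auto
  have "card (W 3 \<union> W 4) + card F \<le> N"
  proof (rule clique_F)
    show "W 3 \<union> W 4 \<subseteq> verts G - {v2}"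
      using W_sub ok2[of 3] ok2[of 4] by auto
    show "pairwise (\<lambda>x y. x \<rightarrow>\<^bsub>G\<^esub> y) (W 3 \<union> W 4)"
      using W(2)[of 3] W(2)[of 4] W_sub adj(5) sym[OF adj(5)]
      by (simp add: pairwise_def subset_iff ball_Un)
    show "x \<rightarrow>\<^bsub>G\<^esub> y" if "x \<in> W 3 \<union> W 4" "y \<in> A 6" for x y
      using that W_sub adj(6,8) by blast
  qed
  moreover have "W 3 \<inter> W 4 = {}"
    using W_sub part[of _ 3 4] by fastforce
  ultimately have F34: "card (W 3) + card (W 4) + card F \<le> N"
    using W(3) by (simp add: card_Un_disjoint)

  obtain Y1 Y2 Y3 Y4 Y5 where
    Y: "Y1 \<subseteq> {..<N}" "Y2 \<subseteq> {..<N}" "Y3 \<subseteq> {..<N}" "Y4 \<subseteq> {..<N}" "Y5 \<subseteq> {..<N}"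
    and card_Y: "card Y1 = card (W 1)" "card Y2 = card (W 2)" "card Y3 = card (W 3)"
      "card Y4 = card (W 4)" "card Y5 = card (W 5)"
    and disj_Y: "Y1 \<inter> Y2 = {}" "Y2 \<inter> Y3 = {}" "Y3 \<inter> Y4 = {}" "Y4 \<inter> Y5 = {}" "Y5 \<inter> Y1 = {}"
      "Y1 \<inter> F = {}" "Y3 \<inter> F = {}" "Y4 \<inter> F = {}"
    by (rule pentagon_palettes[of "{..<N}" F N "card (W 1)" "card (W 2)" "card (W 3)"
          "card (W 4)" "card (W 5)"])
      (use F total F1 F34 edge disj in simp_all)
  have fin_Y: "finite Y1" "finite Y2" "finite Y3" "finite Y4" "finite Y5"
    using Y finite_subset by blast+
  obtain g1 where g1: "g1 ` A 1 \<subseteq> Y1" "\<And>x y. x \<in> A 1 \<Longrightarrow> y \<in> A 1 \<Longrightarrow> x \<rightarrow>\<^bsub>G\<^esub> y \<Longrightarrow> g1 x \<noteq> g1 y"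
    using recolour[OF _ fin_Y(1) card_Y(1)] by auto
  obtain g2 where g2: "g2 ` A 2 \<subseteq> Y2" "\<And>x y. x \<in> A 2 \<Longrightarrow> y \<in> A 2 \<Longrightarrow> x \<rightarrow>\<^bsub>G\<^esub> y \<Longrightarrow> g2 x \<noteq> g2 y"
    using recolour[OF _ fin_Y(2) card_Y(2)] by auto
  obtain g3 where g3: "g3 ` A 3 \<subseteq> Y3" "\<And>x y. x \<in> A 3 \<Longrightarrow> y \<in> A 3 \<Longrightarrow> x \<rightarrow>\<^bsub>G\<^esub> y \<Longrightarrow> g3 x \<noteq> g3 y"
    using recolour[OF _ fin_Y(3) card_Y(3)] by auto
  obtain g4 where g4: "g4 ` A 4 \<subseteq> Y4" "\<And>x y. x \<in> A 4 \<Longrightarrow> y \<in> A 4 \<Longrightarrow> x \<rightarrow>\<^bsub>G\<^esub> y \<Longrightarrow> g4 x \<noteq> g4 y"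
    using recolour[OF _ fin_Y(4) card_Y(4)] by auto
  obtain g5 where g5: "g5 ` A 5 \<subseteq> Y5" "\<And>x y. x \<in> A 5 \<Longrightarrow> y \<in> A 5 \<Longrightarrow> x \<rightarrow>\<^bsub>G\<^esub> y \<Longrightarrow> g5 x \<noteq> g5 y"
    using recolour[OF _ fin_Y(5) card_Y(5)] by auto

  \<comment> \<open>The final branch keeps \<open>b\<close> on \<open>A 6\<close> and
    \<open>A 7\<close>; the other parts take their new palettes.\<close>
  define d where "d x = (if x \<in> A 1 then g1 x else if x \<in> A 2 then g2 x else if x \<in> A 3 then g3 x
    else if x \<in> A 4 then g4 x else if x \<in> A 5 then g5 x else b x)" for x
  have d: "\<And>x. x \<in> A 1 \<Longrightarrow> d x = g1 x" "\<And>x. x \<in> A 2 \<Longrightarrow> d x = g2 x"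
    "\<And>x. x \<in> A 3 \<Longrightarrow> d x = g3 x" "\<And>x. x \<in> A 4 \<Longrightarrow> d x = g4 x" "\<And>x. x \<in> A 5 \<Longrightarrow> d x = g5 x"
    "\<And>x. x \<in> A 6 \<Longrightarrow> d x = b x" "\<And>x. x \<in> A 7 \<Longrightarrow> d x = b x"
    unfolding d_def by (auto dest: part)
  have d_in: "\<And>x. x \<in> A 1 \<Longrightarrow> d x \<in> Y1" "\<And>x. x \<in> A 2 \<Longrightarrow> d x \<in> Y2"
    "\<And>x. x \<in> A 3 \<Longrightarrow> d x \<in> Y3" "\<And>x. x \<in> A 4 \<Longrightarrow> d x \<in> Y4" "\<And>x. x \<in> A 5 \<Longrightarrow> d x \<in> Y5"
    "\<And>x. x \<in> A 6 \<Longrightarrow> d x \<in> F"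
    using g1(1) g2(1) g3(1) g4(1) g5(1) d by (auto simp: F_def)
  have d7: "d x < N" if "x \<in> A 7" for x
    using d(7)[OF that] b(1) ok2[of 7] that by auto
  have cover: "x \<in> A 1 \<or> x \<in> A 2 \<or> x \<in> A 3 \<or> x \<in> A 4 \<or> x \<in> A 5 \<or> x \<in> A 6 \<or> x \<in> A 7"
    if "x \<in> verts G" for x
  proof -
    have "x \<in> (\<Union>i\<in>{1..7}. A i)"
      unfolding union by (fact that)
    then obtain i where i: "i \<in> {1..7}" "x \<in> A i"
      by (rule UN_E)
    then have "i = 1 \<or> i = 2 \<or> i = 3 \<or> i = 4 \<or> i = 5 \<or> i = 6 \<or> i = 7"
      by auto
    then show ?thesis
      using i(2) by auto
  qed
  \<comment> \<open>\<open>ok\<close> is symmetric, so each unordered pair of parts has to be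
    treated only once.\<close>
  define ok where "ok x y \<longleftrightarrow> (x \<rightarrow>\<^bsub>G\<^esub> y \<longrightarrow> d x \<noteq> d y)" for x y
  have ok_sym: "ok x y \<Longrightarrow> ok y x" for x y
    unfolding ok_def using sym by metis
  have ok_nonadj: "\<not> x \<rightarrow>\<^bsub>G\<^esub> y \<Longrightarrow> ok x y" for x y
    by (simp add: ok_def)
  have ok_disj: "d x \<in> Y \<Longrightarrow> d y \<in> Z \<Longrightarrow> Y \<inter> Z = {} \<Longrightarrow> ok x y" for x y Y Z
    unfolding ok_def by auto
  have ok_adj:
    "\<And>x y. x \<in> A 1 \<Longrightarrow> y \<in> A 2 \<Longrightarrow> ok x y" "\<And>x y. x \<in> A 2 \<Longrightarrow> y \<in> A 3 \<Longrightarrow> ok x y"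
    "\<And>x y. x \<in> A 3 \<Longrightarrow> y \<in> A 4 \<Longrightarrow> ok x y" "\<And>x y. x \<in> A 4 \<Longrightarrow> y \<in> A 5 \<Longrightarrow> ok x y"
    "\<And>x y. x \<in> A 5 \<Longrightarrow> y \<in> A 1 \<Longrightarrow> ok x y" "\<And>x y. x \<in> A 1 \<Longrightarrow> y \<in> A 6 \<Longrightarrow> ok x y"
    "\<And>x y. x \<in> A 3 \<Longrightarrow> y \<in> A 6 \<Longrightarrow> ok x y" "\<And>x y. x \<in> A 4 \<Longrightarrow> y \<in> A 6 \<Longrightarrow> ok x y"
    by (rule ok_disj, erule d_in, erule d_in, rule disj_Y)+
  have ok_same:
    "\<And>x y. x \<in> A 1 \<Longrightarrow> y \<in> A 1 \<Longrightarrow> ok x y" "\<And>x y. x \<in> A 2 \<Longrightarrow> y \<in> A 2 \<Longrightarrow> ok x y"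
    "\<And>x y. x \<in> A 3 \<Longrightarrow> y \<in> A 3 \<Longrightarrow> ok x y" "\<And>x y. x \<in> A 4 \<Longrightarrow> y \<in> A 4 \<Longrightarrow> ok x y"
    "\<And>x y. x \<in> A 5 \<Longrightarrow> y \<in> A 5 \<Longrightarrow> ok x y"
    using g1(2) g2(2) g3(2) g4(2) g5(2) d(1-5) by (simp_all add: ok_def)
  \<comment> \<open>\<open>A 7\<close> gets no palette of its own: its neighbours lie in
    \<open>A 6 \<union> A 7\<close>, where \<open>d\<close> agrees with \<open>b\<close>.\<close>
  have ok_67:
    "\<And>x y. x \<in> A 6 \<Longrightarrow> y \<in> A 6 \<Longrightarrow> ok x y" "\<And>x y. x \<in> A 6 \<Longrightarrow> y \<in> A 7 \<Longrightarrow> ok x y"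
    "\<And>x y. x \<in> A 7 \<Longrightarrow> y \<in> A 7 \<Longrightarrow> ok x y"
    using b(2) d(6,7) ok2[of 6] ok2[of 7] by (simp_all add: ok_def subset_iff)
  \<comment> \<open>These 28 facts match the 21 pairs of distinct parts and the 7 single parts;
    \<open>ok_sym\<close> supplies the reversed order in the 49 cases below.\<close>
  note ok = ok_adj ok_same ok_67 nonadj[THEN ok_nonadj]
  have "ok x y" if "x \<in> verts G" "y \<in> verts G" for x y
    using cover[OF that(1)] cover[OF that(2)]
    by (elim disjE)
      ((rule ok, assumption, assumption) | (rule ok_sym, rule ok, assumption, assumption))+
  moreover have "d x < N" if "x \<in> verts G" for x
    using cover[OF that] d_in[of x] d7[of x] Y F by blast
  ultimately have "proper_colouring G N d"
    by (simp add: proper_colouring_def ok_def)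
  then show False
    using vertex_critical_not_colourable[OF crit assms(2)] by (auto simp: colourable_def N_def)
qed

end
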